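(* Let $G$ be a finite simple graph and $v$ a vertex of $G$. Then $v$ is simplicial in $G$ (in the graph sense) if and only if $v$ is simplicial in the clutter $\mathcal{C}_k(G)$ for every integer $k$ with $2 \leq k \leq |V(G)|$.
   Context: A vertex $v$ of a simple graph $G$ is simplicial (in the graph sense) if any two distinct neighbors of $v$ are adjacent in $G$. A clutter $\mathcal{C}$ on a finite vertex set is a set $E(\mathcal{C})$ of subsets of the vertex set, called edges, none of which contains another. A vertex $v$ of a clutter $\mathcal{C}$ is simplicial if for any two distinct edges $e, f \in E(\mathcal{C})$ with $v \in e \cap f$ there exists an edge $g \in E(\mathcal{C})$ with $g \subseteq (e \cup f) \setminus \{v\}$. For $X \subseteq V(G)$, $G[X]$ denotes the subgraph of $G$ induced on $X$. For $2 \leq k \leq |V(G)|$, the $k$-connected graph clutter $\mathcal{C}_k(G)$ is the clutter with vertex set $V(G)$ and edge set $E(\mathcal{C}_k(G)) = \{A \subseteq V(G) : |A| = k \text{ and } G[A] \text{ is connected}\}$. *)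

theory Defs
  imports "Graph_Theory.Digraph_Component"
begin

text \<open>
  A finite simple graph is an element of the locale \<^locale>\<open>graph\<close>: finite, loop-free, without
  parallel arcs, and symmetric, each undirected edge being a pair of opposite arcs.
\<close>

definition graph_simplicial :: "('a, 'b) pre_digraph \<Rightarrow> 'a \<Rightarrow> bool" where
  "graph_simplicial G v \<longleftrightarrow> v \<in> verts G \<and>
     (\<forall>u w. v \<rightarrow>\<^bsub>G\<^esub> u \<and> v \<rightarrow>\<^bsub>G\<^esub> w \<and> u \<noteq> w \<longrightarrow> u \<rightarrow>\<^bsub>G\<^esub> w)"

record 'a pre_clutter =
  cverts :: "'a set"
  cedges :: "'a set set"

locale clutter =
  fixes C :: "'a pre_clutter"
  assumes finite_cverts: "finite (cverts C)"
    and cedges_subset: "e \<in> cedges C \<Longrightarrow> e \<subseteq> cverts C"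
    and cedges_antichain: "e \<in> cedges C \<Longrightarrow> f \<in> cedges C \<Longrightarrow> e \<subseteq> f \<Longrightarrow> e = f"

definition clutter_simplicial :: "'a pre_clutter \<Rightarrow> 'a \<Rightarrow> bool" where
  "clutter_simplicial C v \<longleftrightarrow> v \<in> cverts C \<and>
     (\<forall>e\<in>cedges C. \<forall>f\<in>cedges C. e \<noteq> f \<and> v \<in> e \<inter> f \<longrightarrow>
        (\<exists>g\<in>cedges C. g \<subseteq> (e \<union> f) - {v}))"

definition connected_clutter :: "nat \<Rightarrow> ('a, 'b) pre_digraph \<Rightarrow> 'a pre_clutter" where
  "connected_clutter k G =
     \<lparr>cverts = verts G,
      cedges = {A. A \<subseteq> verts G \<and> card A = k \<and> Digraph_Component.connected (G \<restriction> A)}\<rparr>"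

lemma clutter_connected_clutter:
  assumes "graph G"
  shows "clutter (connected_clutter k G)"
proof -
  interpret graph G by fact
  show ?thesis
  proof
    fix e f
    assume "e \<in> cedges (connected_clutter k G)" "f \<in> cedges (connected_clutter k G)" "e \<subseteq> f"
    moreover from this have "finite f"
      by (auto simp: connected_clutter_def intro: finite_subset[OF _ finite_verts])
    ultimately show "e = f"
      using card_subset_eq[of f e] by (simp add: connected_clutter_def)
  qed (auto simp: connected_clutter_def)
qed

end

theory Submission
  imports Defs
begin

text \<open>
  The clutter with \<open>k = 2\<close> is the edge set of \<open>G\<close> itself: two edges through \<open>v\<close> are \<open>{v, u}\<close> and
  \<open>{v, w}\<close>, and an edge inside their union without \<open>v\<close> can only be \<open>{u, w}\<close>. So simpliciality of
  \<open>v\<close> in that single clutter already makes any two neighbours of \<open>v\<close> adjacent.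

  Conversely, let \<open>v\<close> be simplicial in \<open>G\<close> and let \<open>e \<noteq> f\<close> be connected \<open>k\<close>-sets through \<open>v\<close>. The
  required edge \<open>g\<close> arises from \<open>e\<close> by exchanging \<open>v\<close> for one vertex \<open>b\<close> of \<open>f - e\<close>. Deleting a
  simplicial vertex keeps \<open>e\<close> connected (\<open>connected_delete_simplicial\<close>), so it suffices that \<open>b\<close>
  is adjacent to some vertex of \<open>e - {v}\<close> (\<open>connected_insert_adjacent\<close>). Connectedness of \<open>f\<close> gives
  an adjacent pair \<open>a \<in> e \<inter> f\<close>, \<open>b \<in> f - e\<close>. If \<open>a \<noteq> v\<close>, this is what is needed; if \<open>a = v\<close>, then
  any neighbour of \<open>v\<close> in \<open>e\<close> is adjacent to \<open>b\<close>, as both are neighbours of \<open>v\<close>. No walks are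
  handled along the way, because connectedness enters only in the form that every cut of the vertex
  set is crossed by an arc (\<open>connected_induce_iff_cut\<close>).
\<close>

text \<open>
  A walk from a vertex of \<open>S\<close> to a vertex outside \<open>S\<close> has to leave \<open>S\<close>. In the other direction, the
  cut between the vertices reachable from \<open>u\<close> and the remaining ones is crossed by no arc, so
  nothing can remain.
\<close>

lemma (in sym_digraph) connected_induce_iff_cut:
  "Digraph_Component.connected (G \<restriction> A) \<longleftrightarrow>
     A \<noteq> {} \<and> (\<forall>S. S \<subset> A \<and> S \<noteq> {} \<longrightarrow> (\<exists>x\<in>S. \<exists>y\<in>A - S. x \<rightarrow>\<^bsub>G\<^esub> y))"
  (is "?L \<longleftrightarrow> ?R")
proof -
  define E where "E = parcs (mk_symmetric (G \<restriction> A))"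
  have E_iff: "(x, y) \<in> E \<longleftrightarrow> x \<in> A \<and> y \<in> A \<and> x \<rightarrow>\<^bsub>G\<^esub> y" for x y
    unfolding E_def parcs_mk_symmetric
    using graph_symmetric by (fastforce simp: arcs_ends_conv)
  have conn_iff: "?L \<longleftrightarrow> A \<noteq> {} \<and> (\<forall>u\<in>A. \<forall>w\<in>A. (u, w) \<in> rtrancl_on A E)"
    by (simp add: Digraph_Component.connected_def strongly_connected_def reachable_def E_def)
  show ?thesis
  proof
    assume conn: ?L
    show ?R
    proof (intro conjI allI impI)
      show "A \<noteq> {}"
        using conn conn_iff by blast
      fix S assume S: "S \<subset> A \<and> S \<noteq> {}"
      then obtain s t where st: "s \<in> S" "t \<in> A" "t \<notin> S"
        by blast
      show "\<exists>x\<in>S. \<exists>y\<in>A - S. x \<rightarrow>\<^bsub>G\<^esub> y"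
      proof (rule ccontr)
        assume no_cross: "\<not> ?thesis"
        have "(s, t) \<in> rtrancl_on A E"
          using conn conn_iff S st by blast
        then have "t \<in> S"
          using st(1) no_cross by (induction rule: rtrancl_on_induct) (auto simp: E_iff)
        with st(3) show False ..
      qed
    qed
  next
    assume cuts: ?R
    have "w \<in> {z. (u, z) \<in> rtrancl_on A E}" if "u \<in> A" "w \<in> A" for u w
    proof (rule ccontr)
      let ?S = "{z. (u, z) \<in> rtrancl_on A E}"
      assume "w \<notin> ?S"
      moreover have "?S \<subseteq> A" "u \<in> ?S"
        using that by (auto dest: in_rtrancl_on_in_F)
      ultimately have "?S \<subset> A \<and> ?S \<noteq> {}"
        using that by blast
      then obtain x y where xy: "x \<in> ?S" "y \<in> A - ?S" "x \<rightarrow>\<^bsub>G\<^esub> y"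
        using cuts by meson
      then have "(x, y) \<in> E"
        using \<open>?S \<subseteq> A\<close> by (auto simp: E_iff)
      then show False
        using xy by (auto intro: rtrancl_on_into_rtrancl_on)
    qed
    then show ?L
      using cuts conn_iff by blast
  qed
qed

lemma (in sym_digraph) connected_crossing_arc:
  assumes "Digraph_Component.connected (G \<restriction> A)" "S \<subset> A" "S \<noteq> {}"
  obtains x y where "x \<in> S" "y \<in> A - S" "x \<rightarrow>\<^bsub>G\<^esub> y"
proof -
  have "\<exists>x\<in>S. \<exists>y\<in>A - S. x \<rightarrow>\<^bsub>G\<^esub> y"
    using assms(1)[unfolded connected_induce_iff_cut] assms(2,3) by simp
  then show thesis
    using that by blast
qed

lemma (in sym_digraph) connected_insert_adjacent:
  assumes conn: "Digraph_Component.connected (G \<restriction> A)" and a: "a \<in> A" and ab: "a \<rightarrow>\<^bsub>G\<^esub> b"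
  shows "Digraph_Component.connected (G \<restriction> insert b A)"
  unfolding connected_induce_iff_cut
proof (intro conjI allI impI)
  fix S assume S: "S \<subset> insert b A \<and> S \<noteq> {}"
  have ba: "b \<rightarrow>\<^bsub>G\<^esub> a"
    using ab by (rule graph_symmetric)
  consider "S \<inter> A = {}" | "A \<subseteq> S" | "S \<inter> A \<subset> A" "S \<inter> A \<noteq> {}"
    by blast
  then show "\<exists>x\<in>S. \<exists>y\<in>insert b A - S. x \<rightarrow>\<^bsub>G\<^esub> y"
  proof cases
    case 1
    then have "b \<in> S" "a \<notin> S"
      using S a by auto
    then show ?thesis
      using a ba by blast
  next
    case 2
    then have "b \<notin> S" "a \<in> S"
      using S a by auto
    then show ?thesis
      using ab by blast
  next
    case 3
    then obtain x y where "x \<in> S \<inter> A" "y \<in> A - S \<inter> A" "x \<rightarrow>\<^bsub>G\<^esub> y"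
      using connected_crossing_arc[OF conn] by metis
    then show ?thesis
      by blast
  qed
qed simp

text \<open>
  Suppose that \<open>A - {v}\<close> splits into \<open>S\<close> and \<open>T\<close>. In \<open>A\<close> itself, the cut with \<open>v\<close> on the side of \<open>T\<close>
  and the cut with \<open>v\<close> on the side of \<open>S\<close> are both crossed. Either one of the crossing arcs runs
  from \<open>S\<close> to \<open>T\<close>, or \<open>v\<close> has a neighbour on each side, and these two neighbours are adjacent.
\<close>

lemma (in sym_digraph) connected_delete_simplicial:
  assumes simp_v: "graph_simplicial G v"
    and conn: "Digraph_Component.connected (G \<restriction> A)"
    and v: "v \<in> A" and ne: "A \<noteq> {v}"
  shows "Digraph_Component.connected (G \<restriction> (A - {v}))"
  unfolding connected_induce_iff_cut
proof (intro conjI allI impI)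
  show "A - {v} \<noteq> {}"
    using v ne by blast
  fix S assume S: "S \<subset> A - {v} \<and> S \<noteq> {}"
  obtain s y where sy: "s \<in> S" "y \<in> A - S" "s \<rightarrow>\<^bsub>G\<^esub> y"
    using connected_crossing_arc[OF conn, of S] S by blast
  have "insert v S \<subset> A"
    using S v by blast
  then obtain x t where xt: "x \<in> insert v S" "t \<in> A - insert v S" "x \<rightarrow>\<^bsub>G\<^esub> t"
    using connected_crossing_arc[OF conn] by blast
  show "\<exists>x\<in>S. \<exists>y\<in>A - {v} - S. x \<rightarrow>\<^bsub>G\<^esub> y"
  proof (cases "y = v \<and> x = v")
    case True
    then have "v \<rightarrow>\<^bsub>G\<^esub> s" "v \<rightarrow>\<^bsub>G\<^esub> t"
      using sy xt by (auto intro: graph_symmetric)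
    moreover have "s \<noteq> t"
      using sy xt by blast
    ultimately have "s \<rightarrow>\<^bsub>G\<^esub> t"
      using simp_v unfolding graph_simplicial_def by blast
    then show ?thesis
      using sy xt by blast
  next
    case False
    then show ?thesis
      using sy xt by blast
  qed
qed

lemma (in sym_digraph) connected_exchange_simplicial:
  assumes simp_v: "graph_simplicial G v"
    and e: "Digraph_Component.connected (G \<restriction> e)" and f: "Digraph_Component.connected (G \<restriction> f)"
    and v: "v \<in> e \<inter> f" and ne: "e \<noteq> {v}" and not_sub: "\<not> f \<subseteq> e"
  obtains b where "b \<in> f - e" "Digraph_Component.connected (G \<restriction> insert b (e - {v}))"
proof -
  have "e \<inter> f \<subset> f" "e \<inter> f \<noteq> {}"
    using not_sub v by auto
  then obtain a b where ab: "a \<in> e \<inter> f" "b \<in> f - e \<inter> f" "a \<rightarrow>\<^bsub>G\<^esub> b"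
    using connected_crossing_arc[OF f] by blast
  have "\<exists>c\<in>e - {v}. c \<rightarrow>\<^bsub>G\<^esub> b"
  proof (cases "a = v")
    case True
    have "{v} \<subset> e"
      using v ne by blast
    then obtain x c where "x \<in> {v}" "c \<in> e - {v}" "x \<rightarrow>\<^bsub>G\<^esub> c"
      by (rule connected_crossing_arc[OF e]) simp
    then have c: "c \<in> e - {v}" "v \<rightarrow>\<^bsub>G\<^esub> c"
      by simp_all
    moreover have "c \<noteq> b"
      using c ab by blast
    ultimately have "c \<rightarrow>\<^bsub>G\<^esub> b"
      using simp_v ab True unfolding graph_simplicial_def by blast
    with c show ?thesis
      by blast
  next
    case False
    then show ?thesis
      using ab by blast
  qed
  then obtain c where "c \<in> e - {v}" "c \<rightarrow>\<^bsub>G\<^esub> b" ..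
  moreover have "Digraph_Component.connected (G \<restriction> (e - {v}))"
    using connected_delete_simplicial[OF simp_v e] v ne by blast
  ultimately have "Digraph_Component.connected (G \<restriction> insert b (e - {v}))"
    by (intro connected_insert_adjacent)
  then show thesis
    using ab that by blast
qed

lemma (in graph) clutter_simplicial_of_graph_simplicial:
  assumes simp_v: "graph_simplicial G v" and k: "2 \<le> k"
  shows "clutter_simplicial (connected_clutter k G) v"
  unfolding clutter_simplicial_def
proof (intro conjI ballI impI)
  show "v \<in> cverts (connected_clutter k G)"
    using simp_v by (simp add: connected_clutter_def graph_simplicial_def)
  fix e f
  assume "e \<in> cedges (connected_clutter k G)" "f \<in> cedges (connected_clutter k G)"
    and ef: "e \<noteq> f \<and> v \<in> e \<inter> f"
  then have e: "e \<subseteq> verts G" "card e = k" "Digraph_Component.connected (G \<restriction> e)"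
    and f: "f \<subseteq> verts G" "card f = k" "Digraph_Component.connected (G \<restriction> f)"
    by (auto simp: connected_clutter_def)
  have fin: "finite e"
    using e(1) finite_verts by (rule finite_subset)
  have "\<not> f \<subseteq> e"
    using card_subset_eq[OF fin, of f] e(2) f(2) ef by auto
  moreover have "e \<noteq> {v}"
    using e(2) k by auto
  ultimately obtain b where b: "b \<in> f - e"
      "Digraph_Component.connected (G \<restriction> insert b (e - {v}))"
    using connected_exchange_simplicial[OF simp_v e(3) f(3)] ef by blast
  have "card (insert b (e - {v})) = k"
    using fin b(1) ef e(2) k by (simp add: card_Diff_singleton)
  with b e(1) f(1) have "insert b (e - {v}) \<in> cedges (connected_clutter k G)"
    by (auto simp: connected_clutter_def)
  moreover have "insert b (e - {v}) \<subseteq> (e \<union> f) - {v}"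
    using b(1) ef by blast
  ultimately show "\<exists>g\<in>cedges (connected_clutter k G). g \<subseteq> (e \<union> f) - {v}" ..
qed

lemma (in graph) connected_induce_pair_iff:
  assumes "x \<noteq> y"
  shows "Digraph_Component.connected (G \<restriction> {x, y}) \<longleftrightarrow> x \<rightarrow>\<^bsub>G\<^esub> y"
proof
  assume "Digraph_Component.connected (G \<restriction> {x, y})"
  then obtain a b where "a \<in> {x}" "b \<in> {x, y} - {x}" "a \<rightarrow>\<^bsub>G\<^esub> b"
    by (rule connected_crossing_arc[of _ "{x}"]) (use assms in auto)
  then show "x \<rightarrow>\<^bsub>G\<^esub> y"
    by simp
next
  assume "x \<rightarrow>\<^bsub>G\<^esub> y"
  moreover have "Digraph_Component.connected (G \<restriction> {x})"
    unfolding connected_induce_iff_cut by blast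
  ultimately have "Digraph_Component.connected (G \<restriction> insert y {x})"
    using connected_insert_adjacent[of "{x}" x y] by simp
  then show "Digraph_Component.connected (G \<restriction> {x, y})"
    by (simp add: insert_commute)
qed

lemma (in graph) graph_simplicial_of_clutter_simplicial:
  assumes simp_v: "clutter_simplicial (connected_clutter 2 G) v"
  shows "graph_simplicial G v"
  unfolding graph_simplicial_def
proof (intro conjI allI impI)
  show "v \<in> verts G"
    using simp_v by (simp add: clutter_simplicial_def connected_clutter_def)
  fix u w assume uw: "v \<rightarrow>\<^bsub>G\<^esub> u \<and> v \<rightarrow>\<^bsub>G\<^esub> w \<and> u \<noteq> w"
  have edge: "{v, x} \<in> cedges (connected_clutter 2 G)" if "v \<rightarrow>\<^bsub>G\<^esub> x" for x
    using that adj_not_same[of v] connected_induce_pair_iff[of v x]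
    by (auto simp: connected_clutter_def card_2_iff)
  obtain g where g: "g \<in> cedges (connected_clutter 2 G)" "g \<subseteq> ({v, u} \<union> {v, w}) - {v}"
    using simp_v edge uw unfolding clutter_simplicial_def
    by (metis IntI doubleton_eq_iff insertI1)
  have "g \<subseteq> {u, w}" "card g = card {u, w}"
    using g uw by (auto simp: connected_clutter_def)
  then have "g = {u, w}"
    by (intro card_subset_eq) auto
  then show "u \<rightarrow>\<^bsub>G\<^esub> w"
    using g(1) uw connected_induce_pair_iff[of u w] by (simp add: connected_clutter_def)
qed

theorem theorem4p3:
  fixes G :: "('a, 'b) pre_digraph" and v :: 'a
  assumes "graph G" and "v \<in> verts G"
  shows "graph_simplicial G v \<longleftrightarrow>
    (\<forall>k. 2 \<le> k \<and> k \<le> card (verts G) \<longrightarrow> clutter_simplicial (connected_clutter k G) v)"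
proof -
  interpret graph G by fact
  show ?thesis
  proof (intro iffI allI impI)
    fix k assume "graph_simplicial G v" "2 \<le> k \<and> k \<le> card (verts G)"
    then show "clutter_simplicial (connected_clutter k G) v"
      using clutter_simplicial_of_graph_simplicial by blast
  next
    assume all_k: "\<forall>k. 2 \<le> k \<and> k \<le> card (verts G) \<longrightarrow> clutter_simplicial (connected_clutter k G) v"
    show "graph_simplicial G v"
    proof (cases "2 \<le> card (verts G)")
      case True
      with all_k show ?thesis
        by (intro graph_simplicial_of_clutter_simplicial) simp
    next
      \<comment> \<open>With at most one vertex, the range of \<open>k\<close> is empty, but \<open>v\<close> has at most one neighbour.\<close>
      case False
      then have "u = w" if "u \<in> verts G" "w \<in> verts G" for u w
        using that card_le_Suc0_iff_eq[OF finite_verts] by auto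
      then show ?thesis
        using assms(2) unfolding graph_simplicial_def by (metis adj_in_verts(2))
    qed
  qed
qed

end
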